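(* Let $\boldsymbol\mu\in\mathcal P$ be arbitrary, let $\lambda_1(\boldsymbol\mu)$ be the smallest eigenvalue of the Hermitian matrix $\mathbf A(\boldsymbol\mu)\in\mathbb C^{N\times N}$ and let $\mathcal W_1(\boldsymbol\mu)\subseteq\mathbb C^N$ be the associated eigenspace. Let $\mathcal V\subseteq\mathbb C^N$ be a subspace with $\dim(\mathcal V)=r$ and let $\mathbf V\in\mathbb C^{N\times r}$ be a matrix whose columns form an orthonormal basis of $\mathcal V$. Let $\lambda_1^{\mathcal V}(\boldsymbol\mu)$ be the smallest eigenvalue of $\mathbf A^{\mathbf V}(\boldsymbol\mu):=\mathbf V^*\mathbf A(\boldsymbol\mu)\mathbf V$, let $m_1(\boldsymbol\mu,\mathcal V)$ be its multiplicity, and let $\mathbf w_1^{\mathbf V}(\boldsymbol\mu),\dots,\mathbf w^{\mathbf V}_{m_1(\boldsymbol\mu,\mathcal V)}(\boldsymbol\mu)\in\mathbb C^r$ be a complete orthonormal set of eigenvectors of $\mathbf A^{\mathbf V}(\boldsymbol\mu)$ associated with $\lambda_1^{\mathcal V}(\boldsymbol\mu)$. Let $\mathbf W_1^{\mathbf V}(\boldsymbol\mu)\in\mathbb C^{N\times m_1(\boldsymbol\mu,\mathcal V)}$ be the matrix whose $k$-th column is $\mathbf V\mathbf w_k^{\mathbf V}(\boldsymbol\mu)$ (so that its columns span $\mathcal W_1^{\mathcal V}(\boldsymbol\mu):=\operatorname{span}\{\mathbf V\mathbf w_k^{\mathbf V}(\boldsymbol\mu)\}_{k=1}^{m_1(\boldsymbol\mu,\mathcal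 V)}$), and define the residual matrix $$\mathbf R^{\mathcal V}(\boldsymbol\mu):=\mathbf A(\boldsymbol\mu)\mathbf W_1^{\mathbf V}(\boldsymbol\mu)-\lambda_1^{\mathcal V}(\boldsymbol\mu)\,\mathbf W_1^{\mathbf V}(\boldsymbol\mu).$$ Then $$\big\|\mathbf P^{\mathcal W_1^{\perp}(\boldsymbol\mu)}\,\mathbf W_1^{\mathbf V}(\boldsymbol\mu)\big\|\;\le\;\frac{1}{\gamma(\boldsymbol\mu)}\Big(\lambda_1^{\mathcal V}(\boldsymbol\mu)-\lambda_1(\boldsymbol\mu)+\|\mathbf R^{\mathcal V}(\boldsymbol\mu)\|\Big),$$ where $\gamma(\boldsymbol\mu)$ is the spectral gap of $\mathbf A(\boldsymbol\mu)$.
   Context: $\mathcal P\subseteq\mathbb R^p$ is compact and $\mathbf A:\mathcal P\to\mathbb C^{N\times N}$ is a Hermitian matrix-valued function. Standing assumptions: (i) $\mathbf A(\boldsymbol\mu)=\sum_{q=1}^Q\theta_q(\boldsymbol\mu)\mathbf A_q$ with Hermitian $\mathbf A_q$ and real-valued $\theta_q$; (ii) $\mathbf A$ is real-analytic in $\boldsymbol\mu$; (iii) with $\lambda_1(\boldsymbol\mu)\le\dots\le\lambda_N(\boldsymbol\mu)$ the eigenvalues of $\mathbf A(\boldsymbol\mu)$ counted with multiplicity and $\tilde\lambda_2(\boldsymbol\mu)$ the smallest eigenvalue strictly larger than $\lambda_1(\boldsymbol\mu)$, there is $m_0\in\mathbb N$ with $2\le m_0<N$ (in fact $m_0\ll N$)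 such that $\tilde\lambda_2(\boldsymbol\mu)\le\lambda_{m_0}(\boldsymbol\mu)<\lambda_{m_0+1}(\boldsymbol\mu)$ for all $\boldsymbol\mu\in\mathcal P$. In particular $\mathbf A(\boldsymbol\mu)$ is never a scalar multiple of the identity, and the spectral gap $\gamma(\boldsymbol\mu):=\tilde\lambda_2(\boldsymbol\mu)-\lambda_1(\boldsymbol\mu)>0$ is well defined. $\|\cdot\|$ is the Euclidean norm for vectors and the induced spectral norm for matrices. $\mathbf P^{\mathcal W_1^\perp(\boldsymbol\mu)}$ is the orthogonal projector of $\mathbb C^N$ onto the orthogonal complement of $\mathcal W_1(\boldsymbol\mu)$. *)

theory Defs
  imports
    "HOL-Analysis.Analysis"
    "HOL-Computational_Algebra.Fundamental_Theorem_Algebra"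
begin

text \<open>
  Vectors of \<open>\<complex>\<^sup>N\<close> are \<^typ>\<open>complex^'n\<close> and a matrix with \<open>N\<close> rows and \<open>r\<close> columns is a
  \<^typ>\<open>complex^'r^'n\<close>. The library's inner product on \<^typ>\<open>complex^'n\<close> is the real one (the
  real part of the Hermitian one), so the Hermitian inner product is defined here;
  linear algebra over \<open>\<complex>\<close> is that of the locale interpretation \<open>vec\<close>.
\<close>

definition cinner :: "complex^'n \<Rightarrow> complex^'n \<Rightarrow> complex" where
  "cinner x y = (\<Sum>i\<in>UNIV. cnj (x $ i) * y $ i)"

definition cadjoint :: "complex^'n^'m \<Rightarrow> complex^'m^'n" where
  "cadjoint A = (\<chi> i j. cnj (A $ j $ i))"

definition hermitian :: "complex^'n^'n \<Rightarrow> bool" where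
  "hermitian A \<longleftrightarrow> cadjoint A = A"

definition orthonormal_family :: "('k \<Rightarrow> complex^'n) \<Rightarrow> bool" where
  "orthonormal_family w \<longleftrightarrow> (\<forall>j k. cinner (w j) (w k) = (if j = k then 1 else 0))"

definition spectral_norm :: "complex^'n^'m \<Rightarrow> real" where
  "spectral_norm A = onorm (\<lambda>x. A *v x)"

definition orth_compl :: "(complex^'n) set \<Rightarrow> (complex^'n) set" where
  "orth_compl S = {x. \<forall>y\<in>S. cinner y x = 0}"

definition orth_projector :: "(complex^'n) set \<Rightarrow> complex^'n^'n" where
  "orth_projector S = (THE P. \<forall>x. P *v x \<in> S \<and> x - P *v x \<in> orth_compl S)"

definition eigenspace :: "complex^'n^'n \<Rightarrow> complex \<Rightarrow> (complex^'n) set" where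
  "eigenspace A l = {x. A *v x = l *s x}"

definition eigenvalue :: "complex^'n^'n \<Rightarrow> complex \<Rightarrow> bool" where
  "eigenvalue A l \<longleftrightarrow> (\<exists>x. x \<noteq> 0 \<and> A *v x = l *s x)"

definition charpoly :: "complex^'n^'n \<Rightarrow> complex poly" where
  "charpoly A = det (\<chi> i j. if i = j then [:- (A $ i $ j), 1:] else [:- (A $ i $ j):])"

definition eig_mult :: "complex^'n^'n \<Rightarrow> complex \<Rightarrow> nat" where
  "eig_mult A l = order l (charpoly A)"

text \<open>
  The \<open>k\<close>-th smallest eigenvalue (\<open>1 \<le> k \<le> N\<close>) counted with multiplicity. It is only
  meaningful for Hermitian matrices, for which taking the real part of the eigenvalues
  loses nothing.
\<close>

definition eigval :: "complex^'n^'n \<Rightarrow> nat \<Rightarrow> real" where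
  "eigval A k = sorted_list_of_multiset (image_mset Re (proots (charpoly A))) ! (k - 1)"

definition second_eigval :: "complex^'n^'n \<Rightarrow> real" where
  "second_eigval A = Min {l. eigenvalue A (complex_of_real l) \<and> eigval A 1 < l}"

definition spectral_gap :: "complex^'n^'n \<Rightarrow> real" where
  "spectral_gap A = second_eigval A - eigval A 1"

text \<open>
  Real-analyticity on a set that need not be open: near every point of \<open>S\<close> the function is
  the restriction to \<open>S\<close> of the sum \<open>g\<close> of a power series in \<open>p\<close> real variables that converges
  on a full ball; \<open>\<alpha>\<close> ranges over the multi-indices.
\<close>

definition real_analytic_on :: "(real^'p \<Rightarrow> 'b::real_normed_vector) \<Rightarrow> (real^'p) set \<Rightarrow> bool" where
  "real_analytic_on f S \<longleftrightarrow>
     (\<forall>x\<in>S. \<exists>e>0. \<exists>(c :: ('p \<Rightarrow> nat) \<Rightarrow> 'b) g.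
        (\<forall>y\<in>ball x e. ((\<lambda>\<alpha>. (\<Prod>i\<in>UNIV. (y $ i - x $ i) ^ \<alpha> i) *\<^sub>R c \<alpha>) has_sum g y) UNIV) \<and>
        (\<forall>y\<in>ball x e \<inter> S. f y = g y))"

definition compression :: "complex^'r^'n \<Rightarrow> complex^'n^'n \<Rightarrow> complex^'r^'r" where
  "compression V A = cadjoint V ** A ** V"

text \<open>The matrix whose \<open>k\<close>-th column is \<open>V w\<^sub>k\<close>.\<close>

definition lift_matrix :: "complex^'r^'n \<Rightarrow> ('m \<Rightarrow> complex^'r) \<Rightarrow> complex^'m^'n" where
  "lift_matrix V w = (\<chi> i k. (V *v w k) $ i)"

definition residual_matrix ::
    "complex^'n^'n \<Rightarrow> complex^'r^'n \<Rightarrow> ('m \<Rightarrow> complex^'r) \<Rightarrow> complex^'m^'n" where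
  "residual_matrix A V w =
     A ** lift_matrix V w - eigval (compression V A) 1 *\<^sub>R lift_matrix V w"

end

theory Submission
  imports Defs
begin

text \<open>
  The inequality is a quantitative form of the statement that a small residual forces a Ritz
  vector to lie close to the eigenspace. Write \<open>B\<close> for \<open>A(\<mu>)\<close>, \<open>\<lambda>\<close> for its smallest eigenvalue
  with eigenspace \<open>E\<close>, \<open>\<gamma>\<close> for its spectral gap, \<open>\<rho>\<close> for the smallest Ritz value, \<open>W\<close> for the
  matrix of Ritz vectors and \<open>R = B W - \<rho> W\<close>. Fix \<open>x\<close> and let \<open>u = W x\<close> and \<open>y\<close> the orthogonal
  projection of \<open>u\<close> to \<open>E\<^sup>\<bottom>\<close>. Since \<open>B\<close> maps \<open>E\<^sup>\<bottom>\<close> to itself, the component \<open>u - y\<close> is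
  orthogonal to \<open>y\<close> and to \<open>B y\<close>, so that
  \<open>\<langle>y, R x\<rangle> = \<langle>y, B u - \<rho> u\<rangle> = \<langle>y, B y\<rangle> - \<rho> \<parallel>y\<parallel>\<^sup>2 \<ge> (\<lambda> + \<gamma> - \<rho>) \<parallel>y\<parallel>\<^sup>2\<close>.
  The Cauchy-Schwarz inequality turns this into \<open>\<gamma> \<parallel>y\<parallel> \<le> (\<rho> - \<lambda>) \<parallel>y\<parallel> + \<parallel>R x\<parallel>\<close>, and
  \<open>\<parallel>y\<parallel> \<le> \<parallel>u\<parallel> = \<parallel>x\<parallel>\<close> because the Ritz vectors are orthonormal. As \<open>\<rho> \<ge> \<lambda>\<close>, the factor \<open>\<parallel>y\<parallel>\<close> on
  the right may be replaced by \<open>\<parallel>x\<parallel>\<close>, which gives the claim.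

  The two spectral inputs, \<open>\<rho> \<ge> \<lambda>\<close> and \<open>\<langle>y, B y\<rangle> \<ge> (\<lambda> + \<gamma>) \<parallel>y\<parallel>\<^sup>2\<close> on \<open>E\<^sup>\<bottom>\<close>, both come from
  \<open>self_adjoint_min_on_invariant_subspace\<close>: on an invariant subspace the minimum of the Rayleigh
  quotient is an eigenvalue. Applied to the whole space it bounds the quotient below by \<open>\<lambda>\<close>;
  applied to \<open>E\<^sup>\<bottom>\<close> it produces an eigenvalue different from \<open>\<lambda>\<close>, hence at least \<open>\<lambda> + \<gamma>\<close>.
  What remains is to match the eigenvalues with the roots of the
  characteristic polynomial. Its degree matters here: it makes \<open>\<lambda>\<^sub>m\<close> and \<open>\<lambda>\<^sub>m\<^sub>+\<^sub>1\<close>, for \<open>m = m\<^sub>0\<close>,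
  genuine entries of the list of eigenvalues, so that \<open>\<lambda>\<^sub>m < \<lambda>\<^sub>m\<^sub>+\<^sub>1\<close> exhibits an eigenvalue above
  \<open>\<lambda>\<close> and the gap is the minimum of a nonempty set.
\<close>

section \<open>The Hermitian inner product and the real one\<close>

lemma cinner_add_right: "cinner x (y + z) = cinner x y + cinner x z"
  by (simp add: cinner_def algebra_simps sum.distrib)

lemma cinner_smult_right: "cinner x (c *s y) = c * cinner x y"
  by (simp add: cinner_def sum_distrib_left algebra_simps)

lemma cinner_smult_left: "cinner (c *s x) y = cnj c * cinner x y"
  by (simp add: cinner_def sum_distrib_left algebra_simps)

lemma cinner_zero_right: "cinner x 0 = 0"
  by (simp add: cinner_def)

lemma cinner_commute: "cinner y x = cnj (cinner x y)"
  by (simp add: cinner_def mult.commute)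

lemma inner_eq_Re_cinner: "x \<bullet> y = Re (cinner x y)"
  by (simp add: cinner_def inner_vec_def inner_complex_def)

lemma cinner_self: "cinner x x = complex_of_real ((norm x)\<^sup>2)"
proof -
  have "Im (cinner x x) = 0"
    by (simp add: cinner_def mult.commute)
  then show ?thesis
    by (simp add: complex_eq_iff power2_norm_eq_inner inner_eq_Re_cinner)
qed

lemma cinner_adjoint: "cinner x (A *v y) = cinner (cadjoint A *v x) y"
proof -
  have "cinner x (A *v y) = (\<Sum>i\<in>UNIV. \<Sum>j\<in>UNIV. cnj (x $ i) * A $ i $ j * y $ j)"
    by (simp add: cinner_def matrix_vector_mult_def sum_distrib_left mult.assoc)
  also have "\<dots> = (\<Sum>j\<in>UNIV. \<Sum>i\<in>UNIV. cnj (x $ i) * A $ i $ j * y $ j)"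
    by (rule sum.swap)
  also have "\<dots> = cinner (cadjoint A *v x) y"
    by (simp add: cinner_def matrix_vector_mult_def cadjoint_def sum_distrib_left mult.commute)
  finally show ?thesis .
qed

lemma hermitian_cinner: "hermitian A \<Longrightarrow> cinner x (A *v y) = cinner (A *v x) y"
  by (simp add: cinner_adjoint hermitian_def)

lemma hermitian_inner: "hermitian A \<Longrightarrow> x \<bullet> (A *v y) = (A *v x) \<bullet> y"
  by (simp add: inner_eq_Re_cinner hermitian_cinner)

lemma of_real_smult_eq_scaleR: "complex_of_real c *s x = c *\<^sub>R x"
  by (simp add: vec_eq_iff) (simp add: scaleR_conv_of_real)

lemma isometry_if_orthonormal_columns:
  assumes "orthonormal_family (\<lambda>k. column k V)"
  shows "cinner (V *v x) (V *v y) = cinner x y"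
proof -
  have "cadjoint V ** V = mat 1"
    using assms
    by (simp add: orthonormal_family_def cinner_def column_def vec_eq_iff mat_def
        matrix_matrix_mult_def cadjoint_def)
  then show ?thesis
    by (simp add: cinner_adjoint matrix_vector_mul_assoc)
qed

section \<open>Orthogonal complements and projectors\<close>

lemma subspace_orth_compl: "vec.subspace (orth_compl S)"
  by (auto simp: vec.subspace_def orth_compl_def cinner_zero_right cinner_add_right
      cinner_smult_right)

lemma vec_subspace_imp_subspace:
  fixes S :: "(complex^'n) set"
  assumes "vec.subspace S"
  shows "subspace S"
  using assms by (auto simp: vec.subspace_def subspace_def of_real_smult_eq_scaleR[symmetric])

text \<open>
  The real inner product sees only the real part of the Hermitian one; multiplying by \<open>\<i>\<close>, which
  a complex subspace permits, recovers the imaginary part. Hence real and Hermitian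
  orthogonality to a complex subspace agree.
\<close>

lemma mem_orth_compl_if_orthogonal:
  assumes S: "vec.subspace S" and z: "\<And>s. s \<in> S \<Longrightarrow> orthogonal z s"
  shows "z \<in> orth_compl S"
  unfolding orth_compl_def
proof (intro CollectI ballI)
  fix s assume s: "s \<in> S"
  then have "\<i> *s s \<in> S"
    using S by (auto simp: vec.subspace_def)
  then have "Re (cinner (\<i> *s s) z) = 0" "Re (cinner s z) = 0"
    using z[of "\<i> *s s"] z[OF s] by (simp_all add: orthogonal_def inner_commute flip: inner_eq_Re_cinner)
  then show "cinner s z = 0"
    by (simp add: cinner_smult_left complex_eq_iff)
qed

lemma orth_decomposition_unique:
  assumes S: "vec.subspace S"
    and "a \<in> S" "x - a \<in> orth_compl S" "b \<in> S" "x - b \<in> orth_compl S"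
  shows "a = b"
proof -
  have "a - b \<in> S"
    using assms vec.subspace_diff by blast
  moreover have "a - b \<in> orth_compl S"
    using vec.subspace_diff[OF subspace_orth_compl assms(5) assms(3)] by simp
  ultimately have "cinner (a - b) (a - b) = 0"
    by (simp add: orth_compl_def)
  then show ?thesis
    by (simp add: cinner_self)
qed

lemma orth_projector_works:
  assumes S: "vec.subspace S"
  shows "orth_projector S *v x \<in> S" "x - orth_projector S *v x \<in> orth_compl S"
proof -
  have "\<exists>a. a \<in> S \<and> x - a \<in> orth_compl S" for x
  proof -
    have span: "span S = S"
      using vec_subspace_imp_subspace[OF S] by (simp add: span_eq_iff)
    obtain y z where "y \<in> span S" "\<And>s. s \<in> span S \<Longrightarrow> orthogonal z s" "x = y + z"
      using orthogonal_subspace_decomp_exists[of S x] by metis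
    then have "y \<in> S" "z \<in> orth_compl S" "x - y = z"
      by (auto simp: span intro!: mem_orth_compl_if_orthogonal[OF S])
    then show ?thesis by blast
  qed
  then obtain p where p: "\<And>x. p x \<in> S" "\<And>x. x - p x \<in> orth_compl S"
    by metis
  \<comment> \<open>Uniqueness of the decomposition makes the projection linear, so that it has a matrix.\<close>
  have "p (x + y) = p x + p y" for x y
  proof (rule orth_decomposition_unique[OF S p])
    show "p x + p y \<in> S"
      by (simp add: S p vec.subspace_add)
    show "x + y - (p x + p y) \<in> orth_compl S"
      using vec.subspace_add[OF subspace_orth_compl p(2) p(2), of x y] by (simp add: algebra_simps)
  qed
  moreover have "p (c *s x) = c *s p x" for c x
  proof (rule orth_decomposition_unique[OF S p])
    show "c *s p x \<in> S"
      by (simp add: S p vec.subspace_scale)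
    show "c *s x - c *s p x \<in> orth_compl S"
      using vec.subspace_scale[OF subspace_orth_compl p(2), of c x]
      by (simp add: vec.scale_right_diff_distrib)
  qed
  ultimately have "Vector_Spaces.linear (*s) (*s) p"
    by unfold_locales (auto simp: vec.scale_right_distrib vec.scale_left_distrib)
  then have mat: "matrix p *v x = p x" for x
    by (rule matrix_works)
  have "\<exists>!P. \<forall>x. P *v x \<in> S \<and> x - P *v x \<in> orth_compl S"
  proof (rule ex1I[of _ "matrix p"])
    show "\<forall>x. matrix p *v x \<in> S \<and> x - matrix p *v x \<in> orth_compl S"
      by (simp add: mat p)
  next
    fix P assume P: "\<forall>x. P *v x \<in> S \<and> x - P *v x \<in> orth_compl S"
    have "P *v x = matrix p *v x" for x
      using orth_decomposition_unique[OF S, of "P *v x" x "p x"] P p mat by simp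
    then show "P = matrix p"
      by (simp add: matrix_eq)
  qed
  from theI'[OF this] show "orth_projector S *v x \<in> S" "x - orth_projector S *v x \<in> orth_compl S"
    by (auto simp: orth_projector_def)
qed

lemma norm_orth_projector_le:
  assumes "vec.subspace S"
  shows "norm (orth_projector S *v x) \<le> norm x"
proof -
  let ?p = "orth_projector S *v x"
  have "?p \<bullet> (x - ?p) = 0"
    using orth_projector_works[OF assms, of x] by (simp add: orth_compl_def inner_eq_Re_cinner)
  then have "?p \<bullet> ?p = ?p \<bullet> x"
    by (simp add: inner_diff_right)
  then have "norm ?p * norm ?p \<le> norm ?p * norm x"
    using norm_cauchy_schwarz[of ?p x] by (simp add: power2_norm_eq_inner[symmetric] power2_eq_square)
  then show ?thesis
    by (cases "?p = 0") auto
qed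

section \<open>Minimising the Rayleigh quotient\<close>

text \<open>
  A minimiser of the quadratic form on the unit sphere of \<open>S\<close> exists by compactness. Subtracting
  the minimum \<open>m\<close> gives an operator \<open>g\<close> that is positive semidefinite on \<open>S\<close> and whose form
  vanishes at the minimiser \<open>x\<close>. The form is nonnegative along every line \<open>x + t y\<close> in \<open>S\<close>, so its
  derivative \<open>2 \<langle>y, g x\<rangle>\<close> at \<open>t = 0\<close> vanishes; invariance of \<open>S\<close> allows \<open>y = g x\<close>, hence \<open>g x = 0\<close>.
\<close>

lemma self_adjoint_min_on_invariant_subspace:
  fixes f :: "'a::euclidean_space \<Rightarrow> 'a"
  assumes f: "linear f" and sa: "\<And>x y. x \<bullet> f y = f x \<bullet> y"
    and S: "subspace S" and inv: "\<And>x. x \<in> S \<Longrightarrow> f x \<in> S"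
    and ne: "s \<in> S" "s \<noteq> 0"
  obtains x m where "x \<in> S" "x \<noteq> 0" "f x = m *\<^sub>R x" "\<And>y. y \<in> S \<Longrightarrow> m * (norm y)\<^sup>2 \<le> y \<bullet> f y"
proof -
  let ?K = "S \<inter> sphere 0 1"
  have "compact ?K"
    by (simp add: S closed_Int_compact closed_subspace)
  moreover have "(1 / norm s) *\<^sub>R s \<in> ?K"
    using ne S by (simp add: subspace_scale)
  then have "?K \<noteq> {}"
    by blast
  moreover have "continuous_on ?K (\<lambda>x. x \<bullet> f x)"
    by (intro continuous_intros linear_continuous_on f[unfolded linear_conv_bounded_linear])
  ultimately obtain x where x: "x \<in> ?K" and min: "\<And>y. y \<in> ?K \<Longrightarrow> x \<bullet> f x \<le> y \<bullet> f y"
    using continuous_attains_inf[of ?K "\<lambda>x. x \<bullet> f x"] by blast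
  define m where "m = x \<bullet> f x"
  define g where "g = (\<lambda>y. f y - m *\<^sub>R y)"
  have bound: "m * (norm y)\<^sup>2 \<le> y \<bullet> f y" if y: "y \<in> S" for y
  proof (cases "y = 0")
    case False
    let ?u = "(1 / norm y) *\<^sub>R y"
    have "?u \<in> ?K"
      using y False S by (simp add: subspace_scale)
    then have "m \<le> ?u \<bullet> f ?u"
      using min m_def by blast
    also have "?u \<bullet> f ?u = (y \<bullet> f y) / (norm y)\<^sup>2"
      by (simp add: linear_cmul[OF f] power2_eq_square)
    finally show ?thesis
      using False by (simp add: field_simps)
  qed (simp add: linear_0[OF f])
  have g: "linear g"
    unfolding g_def by (intro linear_compose_sub f linear_scale_self)
  have gsa: "a \<bullet> g b = g a \<bullet> b" for a b
    by (simp add: g_def inner_diff_left inner_diff_right sa)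
  have gpos: "0 \<le> y \<bullet> g y" if "y \<in> S" for y
    using bound[OF that] by (simp add: g_def inner_diff_right power2_norm_eq_inner)
  have gx0: "x \<bullet> g x = 0"
    using x by (simp add: g_def inner_diff_right m_def norm_eq_1)
  have gxS: "g x \<in> S"
    using x S inv by (simp add: g_def subspace_diff subspace_scale)
  define n c where "n = g x \<bullet> g x" and "c = g x \<bullet> g (g x)"
  have quad: "0 \<le> 2 * t * n + t\<^sup>2 * c" for t
  proof -
    have "0 \<le> (x + t *\<^sub>R g x) \<bullet> g (x + t *\<^sub>R g x)"
      using x gxS S by (intro gpos) (simp add: subspace_add subspace_scale)
    also have "\<dots> = 2 * t * n + t\<^sup>2 * c"
      using gx0 gsa[of x "g x"]
      by (simp add: linear_add[OF g] linear_cmul[OF g] inner_add_left inner_add_right n_def c_def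
          power2_eq_square algebra_simps)
    finally show ?thesis .
  qed
  have "0 \<le> c"
    using gpos[OF gxS] by (simp add: c_def)
  have "n \<le> 0"
  proof (rule ccontr)
    assume "\<not> n \<le> 0"
    \<comment> \<open>\<open>t = - n / (1 + c)\<close> is so small that the linear term dominates, making the form negative.\<close>
    have "0 \<le> 2 * (- n / (1 + c)) * n + (- n / (1 + c))\<^sup>2 * c"
      by (rule quad)
    then have "0 \<le> (1 + c)\<^sup>2 * (2 * (- n / (1 + c)) * n + (- n / (1 + c))\<^sup>2 * c)"
      by simp
    also have "\<dots> = - (n\<^sup>2 * (2 + c))"
    proof -
      have "1 + c \<noteq> 0"
        using \<open>0 \<le> c\<close> by simp
      then show ?thesis
        by (simp add: power2_eq_square divide_simps) (simp add: algebra_simps)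
    qed
    finally have "n\<^sup>2 * (2 + c) \<le> 0"
      by simp
    moreover have "0 < n\<^sup>2 * (2 + c)"
      using \<open>0 \<le> c\<close> \<open>\<not> n \<le> 0\<close> by (intro mult_pos_pos) auto
    ultimately show False
      by linarith
  qed
  then have "g x = 0"
    by (metis n_def inner_gt_zero_iff not_le)
  then have "f x = m *\<^sub>R x"
    by (simp add: g_def)
  moreover have "x \<in> S" "x \<noteq> 0"
    using x by auto
  ultimately show ?thesis
    using that bound by blast
qed

section \<open>Eigenvalues as roots of the characteristic polynomial\<close>

lemma poly_det: "poly (det M) l = det (\<chi> i j. poly (M $ i $ j) l)"
  by (simp add: det_def poly_sum poly_prod of_int_poly)

lemma poly_charpoly_eq_0_iff:
  fixes A :: "complex^'n^'n"
  shows "poly (charpoly A) l = 0 \<longleftrightarrow> eigenvalue A l"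
proof -
  let ?M = "mat l - A"
  have "poly (charpoly A) l = det ?M"
    unfolding charpoly_def poly_det
    by (rule arg_cong[where f = det]) (simp add: vec_eq_iff mat_def)
  then have "poly (charpoly A) l = 0 \<longleftrightarrow> \<not> (\<forall>x. ?M *v x = 0 \<longrightarrow> x = 0)"
    using invertible_det_nz[of ?M] invertible_left_inverse[of ?M] matrix_left_invertible_ker[of ?M]
    by auto
  moreover have "mat l *v x = l *s x" for x :: "complex^'n"
    by (simp add: vec_eq_iff matrix_vector_mult_def mat_def if_distrib[of "\<lambda>a. a * _"] cong: if_cong)
  ultimately show ?thesis
    by (auto simp: eigenvalue_def matrix_vector_mult_diff_rdistrib)
qed

text \<open>
  In the Leibniz expansion only the identity permutation meets all the diagonal entries, the sole
  ones of degree one. It contributes a monic product of degree \<open>N\<close>, every other permutation a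
  polynomial of smaller degree.
\<close>

lemma degree_charpoly:
  fixes A :: "complex^'n^'n"
  shows "degree (charpoly A) = CARD('n)"
proof -
  define e where
    "e i j = (if i = j then [:- (A $ i $ j), 1:] else [:- (A $ i $ j):])" for i j
  define T where "T p = of_int (sign p) * (\<Prod>i\<in>UNIV. e i (p i))" for p :: "'n \<Rightarrow> 'n"
  have char: "charpoly A = (\<Sum>p | p permutes UNIV. T p)"
    by (simp add: charpoly_def det_def T_def e_def)
  have dege: "degree (e i j) = (if i = j then 1 else 0)" for i j
    by (simp add: e_def)
  have T: "degree (T p) \<le> (\<Sum>i\<in>UNIV. if i = p i then 1 else 0)" for p
  proof -
    have "degree (T p) \<le> degree (\<Prod>i\<in>UNIV. e i (p i))"
      by (simp add: T_def of_int_poly)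
    also have "\<dots> \<le> (\<Sum>i\<in>UNIV. if i = p i then 1 else 0)"
      using degree_prod_sum_le[of UNIV "\<lambda>i. e i (p i)"] by (simp add: dege o_def)
    finally show ?thesis .
  qed
  have small: "degree (T p) < CARD('n)" if "p \<noteq> id" for p
  proof -
    obtain k where k: "p k \<noteq> k"
      using \<open>p \<noteq> id\<close> by (auto simp: fun_eq_iff)
    have "(\<Sum>i\<in>UNIV. if i = p i then 1 else 0) < (\<Sum>i\<in>(UNIV::'n set). 1::nat)"
      by (rule sum_strict_mono_ex1) (use k in \<open>auto intro!: exI[of _ k]\<close>)
    then show ?thesis
      using T[of p] by simp
  qed
  have "degree (\<Prod>i\<in>UNIV. e i i) = CARD('n)"
    by (subst degree_prod_eq_sum_degree) (auto simp: dege, simp add: e_def)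
  moreover have "lead_coeff (\<Prod>i\<in>UNIV. e i i) = 1"
    by (simp add: lead_coeff_prod e_def)
  ultimately have Tid: "coeff (T id) CARD('n) = 1"
    by (simp add: T_def)
  have "coeff (charpoly A) CARD('n) = (\<Sum>p | p permutes (UNIV::'n set). coeff (T p) CARD('n))"
    by (simp add: char coeff_sum)
  also have "\<dots> = coeff (T id) CARD('n)"
    using small by (subst sum.mono_neutral_right[of _ "{id}"]) (auto simp: permutes_id coeff_eq_0)
  finally have "CARD('n) \<le> degree (charpoly A)"
    using Tid by (intro le_degree) simp
  moreover have "degree (charpoly A) \<le> CARD('n)"
    unfolding char
  proof (rule degree_sum_le)
    fix p :: "'n \<Rightarrow> 'n"
    have "(\<Sum>i\<in>UNIV. if i = p i then 1 else 0) \<le> (\<Sum>i\<in>(UNIV::'n set). 1::nat)"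
      by (rule sum_mono) simp
    then show "degree (T p) \<le> CARD('n)"
      using T[of p] by simp
  qed simp
  ultimately show ?thesis
    by simp
qed

lemma hermitian_eigenvalue_real:
  assumes "hermitian A" "eigenvalue A l"
  shows "l = complex_of_real (Re l)"
proof -
  obtain x where x: "x \<noteq> 0" "A *v x = l *s x"
    using assms(2) by (auto simp: eigenvalue_def)
  then have "l * cinner x x = cnj l * cinner x x"
    using hermitian_cinner[OF assms(1), of x x] by (simp add: cinner_smult_left cinner_smult_right)
  then have "l = cnj l"
    using x(1) by (simp add: cinner_self)
  then show ?thesis
    by (simp add: complex_eq_iff)
qed

definition eigval_list :: "complex^'n^'n \<Rightarrow> real list" where
  "eigval_list A = sorted_list_of_multiset (image_mset Re (proots (charpoly A)))"

lemma eigval_eq_nth: "eigval A k = eigval_list A ! (k - 1)"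
  by (simp add: eigval_def eigval_list_def)

lemma sorted_eigval_list: "sorted (eigval_list A)"
  by (simp add: eigval_list_def)

lemma length_eigval_list:
  fixes A :: "complex^'n^'n"
  shows "length (eigval_list A) = CARD('n)"
proof -
  have "length (eigval_list A) = size (mset (eigval_list A))"
    by simp
  also have "\<dots> = size (proots (charpoly A))"
    by (simp add: eigval_list_def del: size_mset)
  finally show ?thesis
    by (simp add: size_proots_complex degree_charpoly)
qed

lemma set_eigval_list:
  assumes "hermitian A"
  shows "set (eigval_list A) = {l. eigenvalue A (complex_of_real l)}"
proof -
  have "charpoly A \<noteq> 0"
    using degree_charpoly[of A] by force
  then have "set (eigval_list A) = Re ` {z. eigenvalue A z}"
    by (simp add: eigval_list_def poly_charpoly_eq_0_iff)
  also have "\<dots> = {l. eigenvalue A (complex_of_real l)}"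
    using hermitian_eigenvalue_real[OF assms] by (force simp: image_iff)
  finally show ?thesis .
qed

lemma eigval_mono:
  fixes A :: "complex^'n^'n"
  assumes "i \<le> j" "1 \<le> j" "j \<le> CARD('n)"
  shows "eigval A i \<le> eigval A j"
  using assms
  by (auto simp: eigval_eq_nth length_eigval_list intro!: sorted_nth_mono sorted_eigval_list)

lemma eigenvalue_eigval:
  fixes A :: "complex^'n^'n"
  assumes "hermitian A" "1 \<le> k" "k \<le> CARD('n)"
  shows "eigenvalue A (complex_of_real (eigval A k))"
proof -
  have "eigval A k \<in> set (eigval_list A)"
    using assms by (auto simp: eigval_eq_nth length_eigval_list intro!: nth_mem)
  then show ?thesis
    by (simp add: set_eigval_list assms)
qed

lemma eigval_1_le:
  assumes "hermitian A" "eigenvalue A (complex_of_real l)"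
  shows "eigval A 1 \<le> l"
proof -
  have "l \<in> set (eigval_list A)"
    by (simp add: set_eigval_list assms)
  then obtain i where "i < length (eigval_list A)" "l = eigval_list A ! i"
    by (auto simp: in_set_conv_nth)
  then show ?thesis
    by (simp add: eigval_eq_nth sorted_nth_mono sorted_eigval_list)
qed

lemma finite_eigenvalues_above:
  assumes "hermitian A"
  shows "finite {l. eigenvalue A (complex_of_real l) \<and> c < l}"
proof (rule finite_subset)
  show "{l. eigenvalue A (complex_of_real l) \<and> c < l} \<subseteq> set (eigval_list A)"
    by (auto simp: set_eigval_list assms)
qed simp

lemma second_eigval_le:
  assumes "hermitian A" "eigenvalue A (complex_of_real l)" "eigval A 1 < l"
  shows "second_eigval A \<le> l"
  unfolding second_eigval_def using assms finite_eigenvalues_above by (intro Min_le) auto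

lemma spectral_gap_pos:
  assumes "hermitian A" "eigenvalue A (complex_of_real l)" "eigval A 1 < l"
  shows "0 < spectral_gap A"
proof -
  let ?S = "{l. eigenvalue A (complex_of_real l) \<and> eigval A 1 < l}"
  have "Min ?S \<in> ?S"
    using assms finite_eigenvalues_above by (intro Min_in) auto
  then show ?thesis
    by (simp add: spectral_gap_def second_eigval_def)
qed

section \<open>Rayleigh quotient bounds\<close>

lemma eigval_1_le_rayleigh:
  fixes A :: "complex^'n^'n"
  assumes A: "hermitian A"
  shows "eigval A 1 * (norm x)\<^sup>2 \<le> x \<bullet> (A *v x)"
proof -
  obtain s :: "complex^'n" where s: "s \<noteq> 0"
    using zero_neq_one by blast
  obtain z m where z: "z \<noteq> 0" "A *v z = m *\<^sub>R z"
    and m: "\<And>y. m * (norm y)\<^sup>2 \<le> y \<bullet> (A *v y)"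
    using self_adjoint_min_on_invariant_subspace[of "(*v) A" UNIV s] hermitian_inner[OF A] s
    by (auto simp: bounded_linear.linear)
  have "eigenvalue A (complex_of_real m)"
    using z by (auto simp: eigenvalue_def of_real_smult_eq_scaleR)
  then have "eigval A 1 * (norm x)\<^sup>2 \<le> m * (norm x)\<^sup>2"
    by (intro mult_right_mono eigval_1_le A) auto
  then show ?thesis
    using m order_trans by blast
qed

lemma orth_compl_eigenspace_invariant:
  assumes "hermitian A" "x \<in> orth_compl (eigenspace A l)"
  shows "A *v x \<in> orth_compl (eigenspace A l)"
  using assms
  by (auto simp: orth_compl_def eigenspace_def hermitian_cinner cinner_smult_left)

text \<open>
  A minimiser of the Rayleigh quotient on the complement is an eigenvector orthogonal to the
  eigenspace of the smallest eigenvalue, so it belongs to a larger eigenvalue.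
\<close>

lemma second_eigval_le_rayleigh:
  fixes A :: "complex^'n^'n"
  assumes A: "hermitian A"
    and x: "x \<in> orth_compl (eigenspace A (complex_of_real (eigval A 1)))"
  shows "second_eigval A * (norm x)\<^sup>2 \<le> x \<bullet> (A *v x)"
proof (cases "x = 0")
  case False
  let ?E = "eigenspace A (complex_of_real (eigval A 1))"
  have "subspace (orth_compl ?E)"
    by (intro vec_subspace_imp_subspace subspace_orth_compl)
  then obtain z m where z: "z \<in> orth_compl ?E" "z \<noteq> 0" "A *v z = m *\<^sub>R z"
    and m: "\<And>y. y \<in> orth_compl ?E \<Longrightarrow> m * (norm y)\<^sup>2 \<le> y \<bullet> (A *v y)"
    using self_adjoint_min_on_invariant_subspace[of "(*v) A" "orth_compl ?E" x]
      hermitian_inner[OF A] orth_compl_eigenspace_invariant[OF A] x False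
    by (auto simp: bounded_linear.linear)
  have ev: "eigenvalue A (complex_of_real m)"
    using z by (auto simp: eigenvalue_def of_real_smult_eq_scaleR)
  have "m \<noteq> eigval A 1"
  proof
    assume "m = eigval A 1"
    with z have "z \<in> ?E"
      by (simp add: eigenspace_def of_real_smult_eq_scaleR)
    with z have "cinner z z = 0"
      by (simp add: orth_compl_def)
    with z show False
      by (simp add: cinner_self)
  qed
  with eigval_1_le[OF A ev] have "second_eigval A \<le> m"
    by (intro second_eigval_le A ev) simp
  then have "second_eigval A * (norm x)\<^sup>2 \<le> m * (norm x)\<^sup>2"
    by (intro mult_right_mono) auto
  also have "\<dots> \<le> x \<bullet> (A *v x)"
    by (rule m) (rule x)
  finally show ?thesis .
qed simp

section \<open>Ritz vectors and their residual\<close>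

lemma column_lift_matrix: "column k (lift_matrix V w) = V *v w k"
  by (simp add: column_def lift_matrix_def vec_eq_iff)

lemma norm_lift_matrix:
  assumes "orthonormal_family (\<lambda>k. column k V)" "orthonormal_family w"
  shows "norm (lift_matrix V w *v x) = norm x"
proof -
  have "orthonormal_family (\<lambda>k. column k (lift_matrix V w))"
    using assms(2)
    by (simp add: orthonormal_family_def column_lift_matrix isometry_if_orthonormal_columns[OF assms(1)])
  from isometry_if_orthonormal_columns[OF this, of x x] show ?thesis
    by (simp add: norm_eq_sqrt_inner inner_eq_Re_cinner)
qed

lemma residual_matrix_mult:
  "residual_matrix A V w *v x =
     A *v (lift_matrix V w *v x) - eigval (compression V A) 1 *\<^sub>R (lift_matrix V w *v x)"
  by (simp add: residual_matrix_def matrix_vector_mult_diff_rdistrib matrix_vector_mul_assoc)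
     (simp add: vec_eq_iff matrix_vector_mult_def scaleR_sum_right)

text \<open>The Ritz value is a value of the Rayleigh quotient of the full matrix, at a lifted eigenvector.\<close>

lemma eigval_1_le_ritz_value:
  assumes A: "hermitian A" and V: "orthonormal_family (\<lambda>k. column k V)"
    and "eigenvalue (compression V A) (complex_of_real r)"
  shows "eigval A 1 \<le> r"
proof -
  obtain x where x: "x \<noteq> 0" "compression V A *v x = complex_of_real r *s x"
    using assms(3) by (auto simp: eigenvalue_def)
  have iso: "norm (V *v x) = norm x"
    using isometry_if_orthonormal_columns[OF V, of x x]
    by (simp add: norm_eq_sqrt_inner inner_eq_Re_cinner)
  have "cinner x (compression V A *v x) = cnj (cinner (A *v (V *v x)) (V *v x))"
    using cinner_adjoint[of "A *v (V *v x)" V x] cinner_commute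
    by (metis compression_def matrix_vector_mul_assoc)
  then have "x \<bullet> (compression V A *v x) = (V *v x) \<bullet> (A *v (V *v x))"
    by (metis inner_eq_Re_cinner cinner_commute)
  moreover have "x \<bullet> (compression V A *v x) = r * (norm x)\<^sup>2"
    by (simp add: x(2) of_real_smult_eq_scaleR power2_norm_eq_inner)
  ultimately have "eigval A 1 * (norm x)\<^sup>2 \<le> r * (norm x)\<^sup>2"
    using eigval_1_le_rayleigh[OF A, of "V *v x"] iso by simp
  then show ?thesis
    using x(1) by simp
qed

text \<open>
  Testing the residual \<open>A u - r u\<close> against the projection \<open>y\<close> of \<open>u\<close> removes \<open>u - y\<close>, which is
  orthogonal to both \<open>y\<close> and \<open>A y\<close>, and leaves the shifted quadratic form at \<open>y\<close>, where the
  second eigenvalue bounds the Rayleigh quotient from below.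
\<close>

lemma projected_residual_bound:
  fixes A :: "complex^'n^'n" and u :: "complex^'n" and r :: real
  defines "y \<equiv> orth_projector (orth_compl (eigenspace A (complex_of_real (eigval A 1)))) *v u"
  assumes A: "hermitian A"
  shows "spectral_gap A * norm y \<le> (r - eigval A 1) * norm y + norm (A *v u - r *\<^sub>R u)"
proof (cases "y = 0")
  case False
  let ?C = "orth_compl (eigenspace A (complex_of_real (eigval A 1)))"
  have y: "y \<in> ?C" and d: "u - y \<in> orth_compl ?C"
    using orth_projector_works[OF subspace_orth_compl] by (auto simp: y_def)
  have "A *v y \<in> ?C"
    using orth_compl_eigenspace_invariant[OF A y] .
  with d y have "cinner y (u - y) = 0" "cinner (A *v y) (u - y) = 0"
    unfolding orth_compl_def[of ?C] by blast+
  then have orth: "y \<bullet> (u - y) = 0" "(A *v y) \<bullet> (u - y) = 0"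
    by (simp_all add: inner_eq_Re_cinner)
  have "y \<bullet> (A *v u - r *\<^sub>R u) = (A *v y) \<bullet> u - r * (y \<bullet> u)"
    by (simp add: inner_diff_right hermitian_inner[OF A])
  also have "\<dots> = y \<bullet> (A *v y) - r * (norm y)\<^sup>2"
    using orth by (simp add: inner_diff_right power2_norm_eq_inner inner_commute)
  also have "\<dots> \<ge> (second_eigval A - r) * (norm y)\<^sup>2"
    using second_eigval_le_rayleigh[OF A y] by (simp add: algebra_simps)
  finally have "(second_eigval A - r) * (norm y)\<^sup>2 \<le> norm y * norm (A *v u - r *\<^sub>R u)"
    using norm_cauchy_schwarz[of y "A *v u - r *\<^sub>R u"] by linarith
  then have "norm y * ((second_eigval A - r) * norm y) \<le> norm y * norm (A *v u - r *\<^sub>R u)"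
    by (simp add: power2_eq_square algebra_simps)
  then have "(second_eigval A - r) * norm y \<le> norm (A *v u - r *\<^sub>R u)"
    using False by simp
  then show ?thesis
    by (simp add: spectral_gap_def algebra_simps)
qed simp

theorem theorem2p6:
  fixes P :: "(real^'p) set"
    and A :: "real^'p \<Rightarrow> complex^'n^'n"
    and Q m0 :: nat
    and \<theta> :: "nat \<Rightarrow> real^'p \<Rightarrow> real"
    and Aq :: "nat \<Rightarrow> complex^'n^'n"
    and \<mu> :: "real^'p"
    and \<V> :: "(complex^'n) set"
    and V :: "complex^'r^'n"
    and w :: "'m::finite \<Rightarrow> complex^'r"
  assumes "compact P"
    and "\<And>\<nu>. \<nu> \<in> P \<Longrightarrow> hermitian (A \<nu>)"
    and "\<And>q. q \<in> {1..Q} \<Longrightarrow> hermitian (Aq q)"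
    and "\<And>\<nu>. \<nu> \<in> P \<Longrightarrow> A \<nu> = (\<Sum>q=1..Q. \<theta> q \<nu> *\<^sub>R Aq q)"
    and "real_analytic_on A P"
    and "2 \<le> m0" and "m0 < CARD('n)"
    and "\<And>\<nu>. \<nu> \<in> P \<Longrightarrow>
           second_eigval (A \<nu>) \<le> eigval (A \<nu>) m0 \<and> eigval (A \<nu>) m0 < eigval (A \<nu>) (m0 + 1)"
    and "\<mu> \<in> P"
    and "vec.subspace \<V>" and "vec.dim \<V> = CARD('r)"
    and "orthonormal_family (\<lambda>k. column k V)" and "vec.span (columns V) = \<V>"
    and "CARD('m) =
           eig_mult (compression V (A \<mu>)) (complex_of_real (eigval (compression V (A \<mu>)) 1))"
    and "orthonormal_family w"
    and "vec.span (range w) =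
           eigenspace (compression V (A \<mu>)) (complex_of_real (eigval (compression V (A \<mu>)) 1))"
  shows "spectral_norm
           (orth_projector (orth_compl (eigenspace (A \<mu>) (complex_of_real (eigval (A \<mu>) 1))))
              ** lift_matrix V w)
         \<le> 1 / spectral_gap (A \<mu>) *
             (eigval (compression V (A \<mu>)) 1 - eigval (A \<mu>) 1
              + spectral_norm (residual_matrix (A \<mu>) V w))"
proof -
  let ?B = "A \<mu>" and ?W = "lift_matrix V w" and ?R = "residual_matrix (A \<mu>) V w"
  let ?r = "eigval (compression V (A \<mu>)) 1"
  let ?P = "orth_projector (orth_compl (eigenspace ?B (complex_of_real (eigval ?B 1))))"
  have B: "hermitian ?B"
    using assms(2,9) by blast
  have "eigval ?B 1 \<le> eigval ?B m0"
    using assms(6,7) by (intro eigval_mono) auto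
  also have "\<dots> < eigval ?B (m0 + 1)"
    using assms(8,9) by blast
  finally have gap: "0 < spectral_gap ?B"
    using assms(7) eigenvalue_eigval[OF B, of "m0 + 1"] by (intro spectral_gap_pos[OF B]) auto
  have "w k \<in> eigenspace (compression V ?B) (complex_of_real ?r)" "w k \<noteq> 0" for k
  proof -
    show "w k \<in> eigenspace (compression V ?B) (complex_of_real ?r)"
      using vec.span_base[of "w k" "range w"] assms(16) by blast
    have "cinner (w k) (w k) = 1"
      using assms(15) by (simp add: orthonormal_family_def)
    then show "w k \<noteq> 0"
      by (auto simp: cinner_zero_right)
  qed
  then have "eigenvalue (compression V ?B) (complex_of_real ?r)"
    unfolding eigenvalue_def eigenspace_def by blast
  then have ritz: "eigval ?B 1 \<le> ?r"
    by (rule eigval_1_le_ritz_value[OF B assms(12)])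
  have "norm ((?P ** ?W) *v x) \<le>
      1 / spectral_gap ?B * (?r - eigval ?B 1 + spectral_norm ?R) * norm x" for x
  proof -
    let ?y = "?P *v (?W *v x)"
    have "norm ?y \<le> norm x"
      using norm_orth_projector_le[OF subspace_orth_compl] norm_lift_matrix[OF assms(12,15)]
      by metis
    then have "(?r - eigval ?B 1) * norm ?y \<le> (?r - eigval ?B 1) * norm x"
      using ritz by (intro mult_left_mono) auto
    moreover have "norm (?R *v x) \<le> spectral_norm ?R * norm x"
      unfolding spectral_norm_def by (rule onorm) simp
    ultimately have "spectral_gap ?B * norm ?y
        \<le> (?r - eigval ?B 1) * norm x + spectral_norm ?R * norm x"
      using projected_residual_bound[OF B, of "?W *v x" ?r] by (simp add: residual_matrix_mult)
    then show ?thesis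
      using gap by (simp add: field_simps flip: matrix_vector_mul_assoc)
  qed
  then show ?thesis
    unfolding spectral_norm_def by (intro onorm_le)
qed

end
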